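(* Let $G$ be a (possibly infinite) wheel-free simple graph and let $r$ be a positive integer. Then $G$ is $r$-chordal if and only if every cycle of $G$ of length at most $r$ is generated by the triangles of $G$ in the binary cycle space of $G$, i.e., the edge set of each cycle of $G$ of length at most $r$ is the symmetric difference of the edge sets of finitely many triangles of $G$.
   Context: A graph is $r$-chordal if every cycle of length at least $4$ and at most $r$ has a chord. A wheel $W_n$ ($n\ge4$) is a cycle of length $n$ together with a vertex adjacent to all its vertices; a graph is wheel-free if it has no induced subgraph isomorphic to some $W_n$ with $n\ge 4$. A triangle is a cycle of length $3$. The binary cycle space of $G$ is the $\mathbb{Z}_2$-vector space (under symmetric difference) of edge sets generated by edge sets of cycles, where an element is generated by a set $\mathcal{C}$ if it is the symmetric difference of finitely many elements of $\mathcal{C}$. *)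

theory Defs
  imports Main
begin

definition simple_graph :: "'a set \<Rightarrow> 'a set set \<Rightarrow> bool" where
  "simple_graph V E \<longleftrightarrow> (\<forall>e\<in>E. e \<subseteq> V \<and> card e = 2)"

text \<open>A cycle is given by the list of its vertices in cyclic order; the list wraps around, so its
  length is the length of the cycle. Rotations and reversals of the list describe the same cycle.\<close>

definition cycle_edges :: "'a list \<Rightarrow> 'a set set" where
  "cycle_edges c = {{c ! i, c ! (Suc i mod length c)} |i. i < length c}"

definition is_cycle :: "'a set \<Rightarrow> 'a set set \<Rightarrow> 'a list \<Rightarrow> bool" where
  "is_cycle V E c \<longleftrightarrow> 3 \<le> length c \<and> distinct c \<and> set c \<subseteq> V \<and> cycle_edges c \<subseteq> E"

definition has_chord :: "'a set set \<Rightarrow> 'a list \<Rightarrow> bool" where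
  "has_chord E c \<longleftrightarrow> (\<exists>e\<in>E. e \<subseteq> set c \<and> e \<notin> cycle_edges c)"

definition chordal_upto :: "nat \<Rightarrow> 'a set \<Rightarrow> 'a set set \<Rightarrow> bool" where
  "chordal_upto r V E \<longleftrightarrow>
     (\<forall>c. is_cycle V E c \<and> 4 \<le> length c \<and> length c \<le> r \<longrightarrow> has_chord E c)"

definition induced_edges :: "'a set set \<Rightarrow> 'a set \<Rightarrow> 'a set set" where
  "induced_edges E S = {e \<in> E. e \<subseteq> S}"

definition graph_isomorphic :: "'a set \<Rightarrow> 'a set set \<Rightarrow> 'b set \<Rightarrow> 'b set set \<Rightarrow> bool" where
  "graph_isomorphic V E V' E' \<longleftrightarrow>
     (\<exists>f. bij_betw f V V' \<and> (\<forall>u\<in>V. \<forall>v\<in>V. {u, v} \<in> E \<longleftrightarrow> {f u, f v} \<in> E'))"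

text \<open>The rim of the wheel is \<open>0, \<dots>, n - 1\<close> and its hub is \<open>n\<close>.\<close>

definition wheel_verts :: "nat \<Rightarrow> nat set" where
  "wheel_verts n = {0..n}"

definition wheel_edges :: "nat \<Rightarrow> nat set set" where
  "wheel_edges n = cycle_edges [0..<n] \<union> {{i, n} |i. i < n}"

definition wheel_free :: "'a set \<Rightarrow> 'a set set \<Rightarrow> bool" where
  "wheel_free V E \<longleftrightarrow>
     \<not> (\<exists>n\<ge>4. \<exists>S\<subseteq>V. graph_isomorphic S (induced_edges E S) (wheel_verts n) (wheel_edges n))"

definition triangles :: "'a set \<Rightarrow> 'a set set \<Rightarrow> 'a set set set" where
  "triangles V E = {cycle_edges t |t. is_cycle V E t \<and> length t = 3}"

definition generated_by :: "'a set set \<Rightarrow> 'a set \<Rightarrow> bool" where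
  "generated_by \<C> X \<longleftrightarrow> (\<exists>As. set As \<subseteq> \<C> \<and> X = foldr sym_diff As {})"

end

theory Submission
  imports Defs
begin

text \<open>
  If \<open>G\<close> is \<open>r\<close>-chordal, a cycle of length at most \<open>r\<close> is split along chords into triangles.

  Conversely, let a chordless cycle \<open>c\<close> of length at least 4 be a sum of triangles. The vertices \<open>w\<close>
  outside \<open>c\<close> can be removed from these triangles one at a time: the triangles at \<open>w\<close> form the cone
  with apex \<open>w\<close> over a graph \<open>L\<close> in the neighbourhood \<open>N(w)\<close>. As no edge at \<open>w\<close> survives in the sum,
  all degrees of \<open>L\<close> are even and the cone sums to \<open>L\<close>. Since there are no wheels, \<open>N(w)\<close> induces a
  chordal graph, so \<open>L\<close>, a sum of cycles, is a sum of triangles in \<open>N(w)\<close>, and these avoid \<open>w\<close>.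
  In the end all triangles lie on the vertices of \<open>c\<close>, where there are none.
\<close>

section \<open>Symmetric differences\<close>

lemma generated_by_empty: "generated_by C {}"
  unfolding generated_by_def by (rule exI[of _ "[]"]) simp

lemma generated_by_insert:
  assumes "A \<in> C" "generated_by C X"
  shows "generated_by C (sym_diff A X)"
proof -
  obtain As where "set As \<subseteq> C" "X = foldr sym_diff As {}"
    using assms(2) unfolding generated_by_def by blast
  then show ?thesis
    using assms(1) unfolding generated_by_def by (intro exI[of _ "A # As"]) simp
qed

lemma generated_by_induct [consumes 1, case_names empty insert]:
  assumes "generated_by C X"
    and "P {}"
    and "\<And>A Y. A \<in> C \<Longrightarrow> generated_by C Y \<Longrightarrow> P Y \<Longrightarrow> P (sym_diff A Y)"
  shows "P X"
proof -
  obtain As where As: "set As \<subseteq> C" "X = foldr sym_diff As {}"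
    using assms(1) unfolding generated_by_def by blast
  have "P (foldr sym_diff As {})" using As(1)
  proof (induction As)
    case Nil
    then show ?case using assms(2) by simp
  next
    case (Cons A As)
    then have "generated_by C (foldr sym_diff As {})" unfolding generated_by_def by auto
    then show ?case using Cons assms(3) by simp
  qed
  then show ?thesis using As(2) by simp
qed

lemma sym_diff_assoc: "sym_diff (sym_diff A B) C = sym_diff A (sym_diff B C)"
  by blast

lemma sym_diff_swap: "sym_diff (sym_diff A B) (sym_diff C D) = sym_diff (sym_diff A C) (sym_diff B D)"
  by (rule set_eqI) (simp only: Un_iff Diff_iff, argo)

lemma generated_by_sym_diff:
  assumes "generated_by C X" "generated_by C Y"
  shows "generated_by C (sym_diff X Y)"
  using assms
proof (induction X rule: generated_by_induct)
  case empty
  then show ?case by simp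
next
  case (insert A X)
  then show ?case using generated_by_insert[of A C "sym_diff X Y"] by (simp only: sym_diff_assoc)
qed

lemma generated_by_member: "A \<in> C \<Longrightarrow> generated_by C A"
  using generated_by_insert[OF _ generated_by_empty] by fastforce

lemma generated_by_mono: "generated_by C X \<Longrightarrow> C \<subseteq> D \<Longrightarrow> generated_by D X"
  unfolding generated_by_def by blast

section \<open>Parity of vertex degrees\<close>

lemma odd_card_sym_diff:
  assumes "finite A" "finite B"
  shows "odd (card (sym_diff A B)) \<longleftrightarrow> odd (card A) \<noteq> odd (card B)"
proof -
  have "card (sym_diff A B) = card (A - B) + card (B - A)"
    using assms by (intro card_Un_disjoint) auto
  moreover have "card A = card (A - B) + card (A \<inter> B)" "card B = card (B - A) + card (A \<inter> B)"
    using assms by (metis card_Diff_subset_Int card_mono finite_Int inf_le1 le_add_diff_inverse2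
        inf_commute)+
  ultimately show ?thesis by simp blast
qed

text \<open>The boundary of \<open>L\<close> modulo 2. Since \<open>card\<close> is 0 on infinite
  sets, a vertex of infinite degree counts as even; additivity is therefore stated for finite edge
  sets.\<close>

definition odd_vertices :: "'a set set \<Rightarrow> 'a set" where
  "odd_vertices L = {x. odd (card {e \<in> L. x \<in> e})}"

lemma odd_vertices_empty: "odd_vertices {} = {}"
  by (simp add: odd_vertices_def)

lemma odd_vertices_sym_diff:
  assumes "finite A" "finite B"
  shows "odd_vertices (sym_diff A B) = sym_diff (odd_vertices A) (odd_vertices B)"
proof -
  have "{e \<in> sym_diff A B. x \<in> e} = sym_diff {e \<in> A. x \<in> e} {e \<in> B. x \<in> e}" for x
    by blast
  then show ?thesis
    using assms by (auto simp add: odd_vertices_def odd_card_sym_diff)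
qed

lemma odd_vertices_singleton: "odd_vertices {e} = e"
proof -
  have "{d \<in> {e}. x \<in> d} = (if x \<in> e then {e} else {})" for x by auto
  then show ?thesis by (simp add: odd_vertices_def)
qed

section \<open>Paths and cycles\<close>

text \<open>The recursion suits splitting a path at a vertex, unlike the indices of
  \<open>cycle_edges\<close>. A cycle is treated below as the closed path that repeats its first
  vertex at the end.\<close>

fun path_edges :: "'a list \<Rightarrow> 'a set set" where
  "path_edges (x # y # zs) = insert {x, y} (path_edges (y # zs))"
| "path_edges _ = {}"

lemma path_edges_nth: "path_edges p = {{p ! i, p ! Suc i} |i. Suc i < length p}"
proof (induction p rule: path_edges.induct)
  case (1 x y zs)
  have "{{(x # y # zs) ! i, (x # y # zs) ! Suc i} |i. Suc i < length (x # y # zs)} =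
      insert {x, y} {{(y # zs) ! i, (y # zs) ! Suc i} |i. Suc i < length (y # zs)}"
    (is "?A = ?B")
  proof
    show "?A \<subseteq> ?B"
    proof
      fix e assume "e \<in> ?A"
      then obtain i where i: "e = {(x # y # zs) ! i, (x # y # zs) ! Suc i}"
        "Suc i < length (x # y # zs)" by blast
      then show "e \<in> ?B" by (cases i) auto
    qed
    show "?B \<subseteq> ?A"
    proof
      fix e assume "e \<in> ?B"
      then consider "e = {x, y}"
        | i where "e = {(y # zs) ! i, (y # zs) ! Suc i}" "Suc i < length (y # zs)" by blast
      then show "e \<in> ?A"
      proof cases
        case 1
        then show ?thesis by (intro CollectI exI[of _ 0]) simp
      next
        case 2
        then show ?thesis by (intro CollectI exI[of _ "Suc i"]) simp
      qed
    qed
  qed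
  then show ?case using 1 by simp
qed auto

lemma path_edges_append: "path_edges (xs @ y # ys) = path_edges (xs @ [y]) \<union> path_edges (y # ys)"
proof (induction xs)
  case (Cons x xs)
  then show ?case by (cases xs) auto
qed simp

lemma path_edges_subset: "e \<in> path_edges p \<Longrightarrow> e \<subseteq> set p"
  by (induction p rule: path_edges.induct) auto

lemma path_edges_covers: "2 \<le> length p \<Longrightarrow> set p \<subseteq> \<Union> (path_edges p)"
proof (induction p rule: path_edges.induct)
  case (1 x y zs)
  then show ?case by (cases zs) auto
qed auto

lemma cycle_edges_Cons: "cycle_edges (x # xs) = path_edges (x # xs @ [x])"
proof -
  have eq: "{(x # xs) ! i, (x # xs) ! (Suc i mod length (x # xs))} =
      {(x # xs @ [x]) ! i, (x # xs @ [x]) ! Suc i}" if "i < length (x # xs)" for i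
    \<comment> \<open>Only the last index wraps around: there
      \<open>Suc i mod length (x # xs)\<close> is 0, the position of the \<open>x\<close> that is
      appended on the right-hand side.\<close>
    using that by (cases "i = length xs") (auto simp: nth_append nth_Cons split: nat.splits)
  then show ?thesis
    unfolding cycle_edges_def path_edges_nth by fastforce
qed

text \<open>Cut at the first vertices of \<open>xs\<close> and \<open>ys\<close>, both cycles
  consist of the same two paths.\<close>

lemma cycle_edges_rotate: "cycle_edges (xs @ ys) = cycle_edges (ys @ xs)"
proof (cases "xs = [] \<or> ys = []")
  case False
  then obtain x xs' y ys' where xy: "xs = x # xs'" "ys = y # ys'"
    by (metis list.exhaust)
  show ?thesis
    using path_edges_append[of "x # xs'" y "ys' @ [x]"] path_edges_append[of "y # ys'" x "xs' @ [y]"]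
    unfolding xy by (simp add: cycle_edges_Cons Un_commute)
qed auto

lemma cycle_edges_image:
  "cycle_edges c = (\<lambda>i. {c ! i, c ! (Suc i mod length c)}) ` {..<length c}"
  unfolding cycle_edges_def by blast

lemma cycle_edges_map: "cycle_edges (map g c) = (`) g ` cycle_edges c"
  unfolding cycle_edges_image image_image length_map
proof (rule image_cong)
  fix i assume "i \<in> {..<length c}"
  moreover from this have "Suc i mod length c < length c" by (intro mod_less_divisor) auto
  ultimately show "{map g c ! i, map g c ! (Suc i mod length c)} =
      g ` {c ! i, c ! (Suc i mod length c)}" by simp
qed simp

lemma cycle_edges_subset: "e \<in> cycle_edges c \<Longrightarrow> e \<subseteq> set c"
proof (cases c)
  case (Cons x xs)
  assume "e \<in> cycle_edges c"
  then show ?thesis using path_edges_subset[of e "x # xs @ [x]"] by (auto simp: Cons cycle_edges_Cons)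
qed (simp add: cycle_edges_def)

lemma cycle_edges_nonempty: "c \<noteq> [] \<Longrightarrow> cycle_edges c \<noteq> {}"
  unfolding cycle_edges_def by auto

lemma finite_cycle_edges: "finite (cycle_edges c)"
  unfolding cycle_edges_def by simp

section \<open>Triangles as generators\<close>

lemma triangles_iff:
  "T \<in> triangles V E \<longleftrightarrow> (\<exists>a b c. distinct [a, b, c] \<and> {a, b, c} \<subseteq> V \<and>
     {{a, b}, {b, c}, {a, c}} \<subseteq> E \<and> T = {{a, b}, {b, c}, {a, c}})"
proof -
  have edges: "cycle_edges [a, b, c] = {{a, b}, {b, c}, {a, c}}" for a b c :: 'a
    by (simp add: cycle_edges_Cons insert_commute)
  have "T \<in> triangles V E \<longleftrightarrow> (\<exists>a b c. T = cycle_edges [a, b, c] \<and> is_cycle V E [a, b, c])"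
    unfolding triangles_def by (auto simp: length_Suc_conv numeral_3_eq_3)
  then show ?thesis unfolding is_cycle_def edges by auto
qed

lemma triangles_mono: "V \<subseteq> W \<Longrightarrow> triangles V E \<subseteq> triangles W E"
  unfolding triangles_def is_cycle_def by blast

text \<open>The three edges differ, so nothing cancels. In this form the boundary of a triangle
  follows from additivity and \<open>odd_vertices_singleton\<close>.\<close>

lemma triangle_eq_sym_diff:
  assumes "distinct [a, b, c]"
  shows "{{a, b}, {b, c}, {a, c}} = sym_diff {{a, b}} (sym_diff {{b, c}} {{a, c}})"
  using assms by (auto simp: doubleton_eq_iff)

lemma finite_triangle: "T \<in> triangles V E \<Longrightarrow> finite T"
  by (auto simp: triangles_iff)

lemma odd_vertices_triangle:
  assumes "T \<in> triangles V E"
  shows "odd_vertices T = {}"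
proof -
  obtain a b c where T: "distinct [a, b, c]" "T = {{a, b}, {b, c}, {a, c}}"
    using assms by (auto simp: triangles_iff)
  show ?thesis
    unfolding T(2) triangle_eq_sym_diff[OF T(1)] using T(1)
    by (simp only: odd_vertices_sym_diff odd_vertices_singleton finite.intros finite_Un finite_Diff)
      auto
qed

lemma generated_by_triangles_even:
  assumes "generated_by (triangles V E) X"
  shows "finite X \<and> odd_vertices X = {}"
  using assms
proof (induction rule: generated_by_induct)
  case empty
  then show ?case by (simp add: odd_vertices_empty)
next
  case (insert T Y)
  then show ?case
    using odd_vertices_triangle[OF insert(1)] finite_triangle[OF insert(1)]
    by (simp add: odd_vertices_sym_diff)
qed

lemma generated_by_triangles_subset:
  assumes "generated_by (triangles V E) X" "e \<in> X"
  shows "e \<subseteq> V"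
  using assms by (induction arbitrary: e rule: generated_by_induct) (auto simp: triangles_iff)

section \<open>Splitting cycles along chords\<close>

text \<open>The ends of a chord cut the cycle into two arcs. Each arc is closed by the chord to a
  shorter cycle, and the chord cancels in the sum of the two.\<close>

lemma chord_splits_cycle:
  assumes card2: "\<And>e. e \<in> E \<Longrightarrow> card e = 2"
    and cyc: "is_cycle V E c" and chord: "has_chord E c"
  obtains c1 c2 where "is_cycle V E c1" "length c1 < length c"
    "is_cycle V E c2" "length c2 < length c" "cycle_edges c = sym_diff (cycle_edges c1) (cycle_edges c2)"
proof -
  obtain e where e: "e \<in> E" "e \<subseteq> set c" "e \<notin> cycle_edges c"
    using chord unfolding has_chord_def by blast
  obtain x y where xy: "e = {x, y}" "x \<noteq> y"
    using card2[OF e(1)] by (auto simp: card_2_iff)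
  obtain P Q where PQ: "c = P @ x # Q"
    using e(2) xy by (metis insert_subset split_list)
  have "y \<in> set (Q @ P)" using e(2) xy PQ by auto
  then obtain A B where AB: "Q @ P = A @ y # B" by (metis split_list)
  \<comment> \<open>The cycle is rotated to start at \<open>x\<close>; \<open>A\<close> and
    \<open>B\<close> are the interiors of the two arcs.\<close>
  define d where "d = x # A @ y # B"
  have d: "d = x # Q @ P" by (simp add: d_def AB)
  have edges: "cycle_edges c = cycle_edges d"
    using cycle_edges_rotate[of P "x # Q"] by (simp add: PQ d)
  have props: "distinct d" "set d \<subseteq> V" "cycle_edges d \<subseteq> E" "length d = length c"
    using cyc unfolding is_cycle_def edges by (auto simp: PQ d)
  have split: "cycle_edges d = path_edges (x # A @ [y]) \<union> path_edges (y # B @ [x])"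
    using path_edges_append[of "x # A" y "B @ [x]"] by (simp add: d_def cycle_edges_Cons)
  have nonedge: "{x, y} \<notin> path_edges (x # A @ [y])" "{x, y} \<notin> path_edges (y # B @ [x])"
    using e(3) unfolding edges split xy by auto
  \<comment> \<open>An empty interior would make \<open>{x, y}\<close> an edge of the cycle. Both
    being nonempty gives each new cycle at least 3 vertices and makes it shorter than
    \<open>c\<close>.\<close>
  then have "A \<noteq> []" "B \<noteq> []" by (auto simp: insert_commute)
  have c1: "cycle_edges (x # A @ [y]) = insert {x, y} (path_edges (x # A @ [y]))"
    using path_edges_append[of "x # A" y "[x]"] by (auto simp: cycle_edges_Cons insert_commute)
  have c2: "cycle_edges (y # B @ [x]) = insert {x, y} (path_edges (y # B @ [x]))"
    using path_edges_append[of "y # B" x "[y]"] by (auto simp: cycle_edges_Cons)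
  \<comment> \<open>The arcs share only the vertices \<open>x\<close> and \<open>y\<close>, so a
    common edge would be the chord itself.\<close>
  have disj: "path_edges (x # A @ [y]) \<inter> path_edges (y # B @ [x]) = {}"
  proof (rule ccontr)
    assume "\<not> ?thesis"
    then obtain f where f: "f \<in> path_edges (x # A @ [y])" "f \<in> path_edges (y # B @ [x])" by blast
    have "f \<subseteq> {x, y}"
      using path_edges_subset[OF f(1)] path_edges_subset[OF f(2)] props(1) unfolding d_def by auto
    moreover have "card f = 2"
      using f(1) split props(3) card2 by blast
    ultimately have "f = {x, y}"
      using xy(2) by (intro card_subset_eq) auto
    then show False using f(1) nonedge by simp
  qed
  have "{x, y} \<in> E" using e xy by auto
  show ?thesis
  proof (rule that)
    show "is_cycle V E (x # A @ [y])" "is_cycle V E (y # B @ [x])"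
      using props \<open>A \<noteq> []\<close> \<open>B \<noteq> []\<close> \<open>{x, y} \<in> E\<close> split
      unfolding is_cycle_def c1 c2 by (auto simp: d_def Suc_le_eq)
    show "length (x # A @ [y]) < length c" "length (y # B @ [x]) < length c"
      using \<open>A \<noteq> []\<close> \<open>B \<noteq> []\<close> unfolding props(4)[symmetric] d_def by auto
    show "cycle_edges c = sym_diff (cycle_edges (x # A @ [y])) (cycle_edges (y # B @ [x]))"
      unfolding edges split c1 c2 using disj nonedge by blast
  qed
qed

text \<open>Induction on the length: a cycle of length 3 is a generator, and a longer one splits
  along a chord into shorter cycles, still of length at most \<open>r\<close>.\<close>

lemma chordal_cycle_generated_by_triangles:
  assumes card2: "\<And>e. e \<in> E \<Longrightarrow> card e = 2"
    and chordal: "chordal_upto r V E"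
    and "is_cycle V E c" "length c \<le> r"
  shows "generated_by (triangles V E) (cycle_edges c)"
  using assms(3,4)
proof (induction "length c" arbitrary: c rule: less_induct)
  case less
  show ?case
  proof (cases "length c = 3")
    case True
    then show ?thesis
      using less.prems by (intro generated_by_member) (auto simp: triangles_def)
  next
    case False
    then have "4 \<le> length c" using less.prems(1) by (simp add: is_cycle_def)
    then have "has_chord E c"
      using chordal less.prems unfolding chordal_upto_def by blast
    then obtain c1 c2 where c: "is_cycle V E c1" "length c1 < length c"
      "is_cycle V E c2" "length c2 < length c"
      "cycle_edges c = sym_diff (cycle_edges c1) (cycle_edges c2)"
      using chord_splits_cycle[OF card2 less.prems(1)] by blast
    show ?thesis
      unfolding c(5) using less c(1-4) by (intro generated_by_sym_diff) auto
  qed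
qed

text \<open>The first vertex \<open>x\<close> of a longest path has even degree, hence an edge other
  than the first edge of the path. By maximality this edge returns to the path and closes a
  cycle.\<close>

lemma even_graph_has_cycle:
  assumes "finite L" "L \<noteq> {}" and card2: "\<And>e. e \<in> L \<Longrightarrow> card e = 2"
    and even: "odd_vertices L = {}"
  obtains c where "is_cycle (\<Union> L) L c"
proof -
  \<comment> \<open>With at least two vertices, every vertex of the path lies on an edge of
    \<open>L\<close>.\<close>
  define paths where "paths = {p. distinct p \<and> 2 \<le> length p \<and> path_edges p \<subseteq> L}"
  obtain e where e: "e \<in> L" using assms(2) by blast
  then obtain a b where "e = {a, b}" "a \<noteq> b" using card2[OF e] by (auto simp: card_2_iff)
  then have ab: "[a, b] \<in> paths" using e by (simp add: paths_def)
  \<comment> \<open>Finitely many vertices bound the lengths of paths, so a longest path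
    exists.\<close>
  have fin: "finite (\<Union> L)"
    using \<open>finite L\<close> card2 by (metis card.infinite finite_Union zero_neq_numeral)
  have sub: "set p \<subseteq> \<Union> L" if "p \<in> paths" for p
    using that path_edges_covers[of p] unfolding paths_def by blast
  have "length p < Suc (card (\<Union> L))" if "p \<in> paths" for p
  proof -
    have "length p = card (set p)"
      using that unfolding paths_def by (simp add: distinct_card)
    then show ?thesis using card_mono[OF fin sub[OF that]] by simp
  qed
  then obtain p where p: "p \<in> paths" "\<And>q. q \<in> paths \<Longrightarrow> length q \<le> length p"
    using ex_has_greatest_nat[of "\<lambda>p. p \<in> paths" "[a, b]" length] ab by blast
  obtain x y zs where xyz: "p = x # y # zs"
    using p(1) unfolding paths_def by (cases p; cases "tl p") auto
  have xy: "{x, y} \<in> L" using p(1) unfolding paths_def xyz by auto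
  have "even (card {e \<in> L. x \<in> e})" using even by (auto simp: odd_vertices_def)
  then have "{e \<in> L. x \<in> e} \<noteq> {{x, y}}" by force
  then obtain f where f: "f \<in> L" "x \<in> f" "f \<noteq> {x, y}" using xy by blast
  then obtain u where u: "f = {x, u}" "u \<noteq> x"
    using card2[OF f(1)] by (auto simp: card_2_iff)
  have "u \<in> set p"
  proof (rule ccontr)
    assume "u \<notin> set p"
    then have "u # p \<in> paths"
      using p(1) f(1) u by (auto simp: paths_def xyz insert_commute)
    then show False using p(2) by fastforce
  qed
  \<comment> \<open>As \<open>u\<close> is neither \<open>x\<close> nor \<open>y\<close>, the closed
    cycle has at least 3 vertices.\<close>
  then have "u \<in> set zs" using u f(3) unfolding xyz by auto
  then obtain A B where AB: "zs = A @ u # B" by (metis split_list)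
  let ?c = "x # y # A @ [u]"
  have "path_edges ?c \<subseteq> L"
    using p(1) path_edges_append[of "x # y # A" u B] unfolding paths_def xyz AB append_Cons by blast
  moreover have "cycle_edges ?c = path_edges ?c \<union> {{u, x}}"
    using path_edges_append[of "x # y # A" u "[x]"] by (simp add: cycle_edges_Cons)
  ultimately have "cycle_edges ?c \<subseteq> L"
    using f(1) u by (simp add: insert_commute)
  moreover have "distinct ?c" "set ?c \<subseteq> \<Union> L"
    using p(1) sub[OF p(1)] unfolding paths_def xyz AB by auto
  ultimately show ?thesis
    using that[of ?c] unfolding is_cycle_def by simp
qed

text \<open>Induction on the number of edges, removing one cycle at a time. The cycle found in
  \<open>L\<close> has no prescribed length, so chordality is assumed for every
  \<open>r\<close>.\<close>

lemma chordal_even_generated_by_triangles: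
  assumes card2: "\<And>e. e \<in> E \<Longrightarrow> card e = 2"
    and chordal: "\<And>r. chordal_upto r V E"
    and "finite L" "L \<subseteq> E" "\<Union> L \<subseteq> V" "odd_vertices L = {}"
  shows "generated_by (triangles V E) L"
  using assms(3-)
proof (induction "card L" arbitrary: L rule: less_induct)
  case less
  show ?case
  proof (cases "L = {}")
    case True
    then show ?thesis by (simp add: generated_by_empty)
  next
    case False
    then obtain c where c: "is_cycle (\<Union> L) L c"
      using even_graph_has_cycle[of L] less.prems card2 by blast
    then have sub: "cycle_edges c \<subseteq> L" by (simp add: is_cycle_def)
    have "is_cycle V E c" using c less.prems unfolding is_cycle_def by blast
    then have gen: "generated_by (triangles V E) (cycle_edges c)"
      using chordal_cycle_generated_by_triangles[OF card2 chordal] by blast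
    let ?M = "sym_diff (cycle_edges c) L"
    have M: "?M = L - cycle_edges c" using sub by blast
    have "?M \<subset> L"
      using sub cycle_edges_nonempty[of c] c unfolding M is_cycle_def by fastforce
    \<comment> \<open>That the cycle itself has even degrees is read off from its being a sum of
      triangles.\<close>
    moreover have "odd_vertices ?M = {}"
      using generated_by_triangles_even[OF gen] less.prems by (simp add: odd_vertices_sym_diff)
    ultimately have "generated_by (triangles V E) ?M"
      using less.prems finite_cycle_edges[of c] by (intro less.hyps psubset_card_mono) blast+
    then have "generated_by (triangles V E) (sym_diff (cycle_edges c) ?M)"
      by (rule generated_by_sym_diff[OF gen])
    moreover have "sym_diff (cycle_edges c) ?M = L" by blast
    ultimately show ?thesis by simp
  qed
qed

section \<open>Eliminating vertices\<close>

text \<open>The cycle is the rim and \<open>w\<close> the hub of an induced wheel: without chords,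
  the rim vertices span no edges beyond those of the cycle.\<close>

lemma chordless_cycle_in_neighbourhood_not_wheel_free:
  assumes card2: "\<And>e. e \<in> E \<Longrightarrow> card e = 2"
    and cyc: "is_cycle V E c" "4 \<le> length c" and chordless: "\<not> has_chord E c"
    and hub: "w \<in> V" "\<And>x. x \<in> set c \<Longrightarrow> {w, x} \<in> E"
  shows "\<not> wheel_free V E"
proof -
  define n where "n = length c"
  \<comment> \<open>\<open>g\<close> sends the standard wheel into the graph: the rim position
    \<open>i\<close> to \<open>c ! i\<close>, the hub \<open>n\<close> to \<open>w\<close>.\<close>
  define g where "g i = (if i < n then c ! i else w)" for i
  let ?S = "insert w (set c)"
  have loop: "{v, v} \<notin> E" for v using card2[of "{v, v}"] by auto
  have w: "w \<notin> set c" using hub(2)[of w] loop by blast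
  have c: "c = map g [0..<n]"
    by (rule nth_equalityI) (auto simp: n_def g_def)
  have "distinct c" using cyc unfolding is_cycle_def by blast
  have inj: "inj_on g {0..n}"
    using w \<open>distinct c\<close> unfolding inj_on_def g_def n_def
    by (auto simp: nth_eq_iff_index_eq)
  have verts: "{0..n} = insert n {0..<n}" by auto
  have "g ` {0..n} = ?S"
  proof -
    have "g ` {0..<n} = set c" by (subst c) simp
    moreover have "g n = w" by (simp add: g_def)
    ultimately show ?thesis unfolding verts by simp
  qed
  then have bij: "bij_betw g {0..n} ?S" using inj by (simp add: bij_betw_def)
  have rim: "{i, j} \<in> cycle_edges [0..<n] \<longleftrightarrow> {g i, g j} \<in> E" if "i < n" "j < n" for i j
  proof -
    have "{g i, g j} \<in> E \<longleftrightarrow> {g i, g j} \<in> cycle_edges c"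
      using cyc chordless that unfolding has_chord_def is_cycle_def by (auto simp: g_def n_def)
    also have "\<dots> \<longleftrightarrow> g ` {i, j} \<in> (`) g ` cycle_edges [0..<n]"
      by (subst c) (simp add: cycle_edges_map)
    also have "\<dots> \<longleftrightarrow> {i, j} \<in> cycle_edges [0..<n]"
    proof
      assume "g ` {i, j} \<in> (`) g ` cycle_edges [0..<n]"
      then obtain f where f: "f \<in> cycle_edges [0..<n]" "g ` {i, j} = g ` f" by blast
      have "f \<subseteq> {0..n}" using cycle_edges_subset[OF f(1)] by auto
      then have "{i, j} = f"
        using f(2) inj that by (subst (asm) inj_on_image_eq_iff[of g "{0..n}"]) auto
      then show "{i, j} \<in> cycle_edges [0..<n]" using f(1) by simp
    qed blast
    finally show ?thesis by simp
  qed
  have rim_sub: "e \<subseteq> {0..<n}" if "e \<in> cycle_edges [0..<n]" for e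
    using cycle_edges_subset[OF that] by simp
  have wheel: "{i, j} \<in> wheel_edges n \<longleftrightarrow> {g i, g j} \<in> E" if ij: "i \<le> n" "j \<le> n" for i j
  proof -
    have spoke: "{g k, g n} \<in> E" if "k < n" for k
      using hub(2)[of "c ! k"] that by (simp add: g_def n_def insert_commute)
    consider "i < n" "j < n" | "i < n" "j = n" | "i = n" "j < n" | "i = n" "j = n"
      using ij by linarith
    then show ?thesis
    proof cases
      case 1
      then show ?thesis using rim unfolding wheel_edges_def by (auto simp: doubleton_eq_iff)
    next
      case 2
      then show ?thesis using spoke unfolding wheel_edges_def by auto
    next
      case 3
      then show ?thesis using spoke[of j] unfolding wheel_edges_def by (auto simp: insert_commute)
    next
      \<comment> \<open>\<open>graph_isomorphic\<close> also compares \<open>u = v\<close>; neither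
        graph has a loop at its hub.\<close>
      case 4
      then show ?thesis
        using loop rim_sub[of "{n}"] unfolding wheel_edges_def by (auto simp: doubleton_eq_iff)
    qed
  qed
  \<comment> \<open>The isomorphism has to go from the graph to the wheel, so \<open>g\<close> is
    inverted.\<close>
  define f where "f = inv_into {0..n} g"
  have f: "bij_betw f ?S {0..n}" unfolding f_def by (rule bij_betw_inv_into[OF bij])
  have fg: "f v \<le> n" "g (f v) = v" if "v \<in> ?S" for v
    using bij_betw_apply[OF f that] bij_betw_inv_into_right[OF bij that] by (auto simp: f_def)
  have "graph_isomorphic ?S (induced_edges E ?S) (wheel_verts n) (wheel_edges n)"
    unfolding graph_isomorphic_def wheel_verts_def induced_edges_def
    using f wheel[OF fg(1) fg(1)] fg(2) by (intro exI[of _ f]) auto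
  moreover have "?S \<subseteq> V" using cyc hub(1) by (auto simp: is_cycle_def)
  ultimately show ?thesis
    using cyc(2) unfolding wheel_free_def n_def by blast
qed

text \<open>For a finite graph \<open>L\<close> that avoids \<open>w\<close>, this is the sum of the
  triangles on \<open>w\<close>, \<open>a\<close>, \<open>b\<close> over the edges
  \<open>{a, b}\<close> of \<open>L\<close>: the edge \<open>{w, x}\<close> occurs once for each
  edge at \<open>x\<close>, so it survives exactly at odd degree.\<close>

definition cone :: "'a \<Rightarrow> 'a set set \<Rightarrow> 'a set set" where
  "cone w L = sym_diff L ((\<lambda>x. {w, x}) ` odd_vertices L)"

lemma cone_sym_diff:
  assumes "finite L" "finite M"
  shows "cone w (sym_diff L M) = sym_diff (cone w L) (cone w M)"
proof -
  have "inj (\<lambda>x. {w, x})" by (auto simp: inj_on_def doubleton_eq_iff)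
  then have "(\<lambda>x. {w, x}) ` odd_vertices (sym_diff L M) =
      sym_diff ((\<lambda>x. {w, x}) ` odd_vertices L) ((\<lambda>x. {w, x}) ` odd_vertices M)"
    by (simp add: odd_vertices_sym_diff[OF assms] image_Un image_set_diff)
  then show ?thesis by (simp only: cone_def sym_diff_swap)
qed

lemma triangle_at_vertex:
  assumes "T \<in> triangles (insert w S) E" "T \<notin> triangles S E"
  obtains a b where "a \<in> S" "b \<in> S" "{w, a} \<in> E" "{w, b} \<in> E" "{a, b} \<in> E" "T = cone w {{a, b}}"
proof -
  obtain a b c where T: "distinct [a, b, c]" "{a, b, c} \<subseteq> insert w S"
    "{{a, b}, {b, c}, {a, c}} \<subseteq> E" "T = {{a, b}, {b, c}, {a, c}}"
    using assms(1) by (auto simp: triangles_iff)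
  have cone: "cone w {{x, y}} = {{w, x}, {w, y}, {x, y}}" if "x \<noteq> w" "y \<noteq> w" for x y
    using that by (auto simp: cone_def odd_vertices_singleton doubleton_eq_iff)
  have "\<not> {a, b, c} \<subseteq> S" using assms(2) T by (auto simp: triangles_iff)
  then consider "a = w" | "b = w" | "c = w" using T(2) by blast
  then show ?thesis
  proof cases
    case 1
    show ?thesis by (rule that[of b c]) (use 1 T cone[of b c] in \<open>auto simp: insert_commute\<close>)
  next
    case 2
    show ?thesis by (rule that[of a c]) (use 2 T cone[of a c] in \<open>auto simp: insert_commute\<close>)
  next
    case 3
    show ?thesis by (rule that[of a b]) (use 3 T cone[of a b] in \<open>auto simp: insert_commute\<close>)
  qed
qed

text \<open>The summands are sorted: triangles within \<open>S\<close> are collected in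
  \<open>Y\<close>, and each of the others contributes its edge opposite \<open>w\<close> to
  \<open>L\<close>. Additivity of \<open>cone\<close> keeps the equation.\<close>

lemma generated_by_triangles_cone:
  assumes "generated_by (triangles (insert w S) E) X"
  obtains Y L where "generated_by (triangles S E) Y" "finite L" "L \<subseteq> E"
    "\<Union> L \<subseteq> {x \<in> S. {w, x} \<in> E}" "X = sym_diff Y (cone w L)"
proof -
  have "\<exists>Y L. generated_by (triangles S E) Y \<and> finite L \<and> L \<subseteq> E \<and>
      \<Union> L \<subseteq> {x \<in> S. {w, x} \<in> E} \<and> X = sym_diff Y (cone w L)"
    using assms
  proof (induction rule: generated_by_induct)
    case empty
    show ?case
      by (intro exI[of _ "{}"]) (simp add: generated_by_empty cone_def odd_vertices_empty)
  next
    case (insert T X)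
    then obtain Y L where YL: "generated_by (triangles S E) Y" "finite L" "L \<subseteq> E"
      "\<Union> L \<subseteq> {x \<in> S. {w, x} \<in> E}" "X = sym_diff Y (cone w L)" by blast
    show ?case
    proof (cases "T \<in> triangles S E")
      case True
      have "generated_by (triangles S E) (sym_diff T Y)"
        using generated_by_insert[OF True YL(1)] .
      moreover have "sym_diff T X = sym_diff (sym_diff T Y) (cone w L)"
        unfolding YL(5) by blast
      ultimately show ?thesis using YL(2-4) by (intro exI[of _ "sym_diff T Y"] exI[of _ L]) simp
    next
      case False
      obtain a b where ab: "a \<in> S" "b \<in> S" "{w, a} \<in> E" "{w, b} \<in> E" "{a, b} \<in> E"
        "T = cone w {{a, b}}"
        using triangle_at_vertex[OF insert(1) False] by blast
      \<comment> \<open>The edge may already be in \<open>L\<close>; then the two triangles over it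
        cancel, hence a sum and not an insertion.\<close>
      let ?M = "sym_diff {{a, b}} L"
      have "sym_diff T X = sym_diff Y (cone w ?M)"
        unfolding YL(5) ab(6) using cone_sym_diff[of "{{a, b}}" L w] YL(2) by auto
      moreover have "finite ?M" "?M \<subseteq> E" using YL ab by auto
      moreover have "\<Union> ?M \<subseteq> {x \<in> S. {w, x} \<in> E}" using YL ab by blast
      ultimately show ?thesis using YL(1) by (intro exI[of _ Y] exI[of _ ?M]) simp
    qed
  qed
  then show ?thesis using that by blast
qed

lemma wheel_free_eliminate_vertex:
  assumes card2: "\<And>e. e \<in> E \<Longrightarrow> card e = 2"
    and wf: "wheel_free V E" and V: "insert w S \<subseteq> V" and w: "w \<notin> S"
    and gen: "generated_by (triangles (insert w S) E) X" and X: "\<And>e. e \<in> X \<Longrightarrow> w \<notin> e"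
  shows "generated_by (triangles S E) X"
proof -
  let ?N = "{x \<in> S. {w, x} \<in> E}"
  obtain Y L where YL: "generated_by (triangles S E) Y" "finite L" "L \<subseteq> E"
    "\<Union> L \<subseteq> ?N" "X = sym_diff Y (cone w L)"
    using generated_by_triangles_cone[OF gen] by blast
  \<comment> \<open>The edge from \<open>w\<close> to an odd vertex lies in neither \<open>L\<close>
    nor \<open>Y\<close>, whose edges stay inside \<open>S\<close>; it would survive in
    \<open>X\<close>.\<close>
  have odd: "odd_vertices L = {}"
  proof (rule ccontr)
    assume "odd_vertices L \<noteq> {}"
    then obtain x where x: "x \<in> odd_vertices L" by blast
    have "{w, x} \<notin> L" using YL(4) w by blast
    moreover have "{w, x} \<notin> Y" using generated_by_triangles_subset[OF YL(1)] w by blast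
    ultimately have "{w, x} \<in> X" unfolding YL(5) cone_def using x by blast
    then show False using X by blast
  qed
  \<comment> \<open>A chordless cycle of length at least 4 among the neighbours of \<open>w\<close>
    would be the rim of a wheel.\<close>
  have "chordal_upto r ?N E" for r
    unfolding chordal_upto_def
  proof (intro allI impI, elim conjE)
    fix c assume c: "is_cycle ?N E c" "4 \<le> length c"
    then have "is_cycle V E c" "\<And>x. x \<in> set c \<Longrightarrow> {w, x} \<in> E"
      using V unfolding is_cycle_def by auto
    then show "has_chord E c"
      using chordless_cycle_in_neighbourhood_not_wheel_free[OF card2 _ c(2)] wf V by blast
  qed
  then have "generated_by (triangles ?N E) L"
    using chordal_even_generated_by_triangles[of E ?N L] card2 YL odd by blast
  then have "generated_by (triangles S E) L"
    by (rule generated_by_mono) (rule triangles_mono, blast)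
  \<comment> \<open>Without odd vertices the cone over \<open>L\<close> is \<open>L\<close> itself,
    so \<open>X\<close> is the sum of \<open>Y\<close> and \<open>L\<close>.\<close>
  then show ?thesis
    using generated_by_sym_diff[OF YL(1)] YL(5) odd by (simp add: cone_def)
qed

lemma wheel_free_eliminate_vertices:
  assumes card2: "\<And>e. e \<in> E \<Longrightarrow> card e = 2" and wf: "wheel_free V E"
    and "finite F" "F \<inter> S = {}" "F \<union> S \<subseteq> V"
    and "generated_by (triangles (F \<union> S) E) X" and X: "\<Union> X \<subseteq> S"
  shows "generated_by (triangles S E) X"
  using assms(3-6)
proof (induction F rule: finite_induct)
  case (insert w F)
  have "generated_by (triangles (F \<union> S) E) X"
  proof (rule wheel_free_eliminate_vertex[OF card2 wf, of w])
    show "generated_by (triangles (insert w (F \<union> S)) E) X" using insert.prems by simp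
  qed (use insert X in blast)+
  then show ?case using insert.IH insert.prems by blast
qed simp

section \<open>Finite support and the end of the elimination\<close>

lemma generated_by_triangles_finite:
  assumes "generated_by (triangles V E) X"
  obtains F where "finite F" "F \<subseteq> V" "generated_by (triangles F E) X"
proof -
  have "\<exists>F. finite F \<and> F \<subseteq> V \<and> generated_by (triangles F E) X"
    using assms
  proof (induction rule: generated_by_induct)
    case empty
    show ?case by (rule exI[of _ "{}"]) (simp add: generated_by_empty)
  next
    case (insert T X)
    then obtain F where F: "finite F" "F \<subseteq> V" "generated_by (triangles F E) X" by blast
    obtain a b c where abc: "{a, b, c} \<subseteq> V" "T \<in> triangles {a, b, c} E"
      using insert(1) unfolding triangles_iff by blast
    let ?F = "{a, b, c} \<union> F"
    have "T \<in> triangles ?F E" using abc triangles_mono[of "{a, b, c}" ?F E] by blast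
    moreover have "generated_by (triangles ?F E) X"
      using F(3) by (rule generated_by_mono) (rule triangles_mono, blast)
    ultimately have "generated_by (triangles ?F E) (sym_diff T X)"
      by (rule generated_by_insert)
    moreover have "finite ?F" "?F \<subseteq> V" using F abc by auto
    ultimately show ?case by (intro exI[of _ ?F]) simp
  qed
  then show ?thesis using that by blast
qed

text \<open>Without chords, a triangle on these vertices would consist of edges of the cycle. A
  vertex \<open>x\<close> has only two neighbours \<open>p\<close> and \<open>q\<close> along the
  cycle, and these are not consecutive when the length is at least 4.\<close>

lemma chordless_cycle_no_triangles:
  assumes "distinct c" "4 \<le> length c" "\<not> has_chord E c"
  shows "triangles (set c) E = {}"
proof (rule ccontr)
  assume "triangles (set c) E \<noteq> {}"
  then obtain T where "T \<in> triangles (set c) E" by blast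
  then obtain x y z where xyz: "distinct [x, y, z]" "{x, y, z} \<subseteq> set c"
    "{{x, y}, {y, z}, {x, z}} \<subseteq> E"
    unfolding triangles_iff by (elim exE conjE)
  then have edges: "{{x, y}, {y, z}, {x, z}} \<subseteq> cycle_edges c"
    using assms(3) unfolding has_chord_def by simp
  obtain P Q where PQ: "c = P @ x # Q" using xyz(2) by (metis insert_subset split_list)
  define D where "D = Q @ P"
  have c: "cycle_edges c = cycle_edges (x # D)"
    using cycle_edges_rotate[of P "x # Q"] by (simp add: PQ D_def)
  have D: "distinct (x # D)" "3 \<le> length D" using assms(1,2) by (auto simp: PQ D_def)
  \<comment> \<open>\<open>D\<close> is the cycle without \<open>x\<close>, from one neighbour of
    \<open>x\<close> to the other; \<open>M\<close> is nonempty since \<open>D\<close> has at least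
    3 vertices.\<close>
  obtain p M q where pMq: "D = p # M @ [q]" "M \<noteq> []"
  proof -
    obtain p D' where "D = p # D'" using D(2) by (cases D) auto
    moreover obtain M q where "D' = M @ [q]"
      using D(2) calculation by (cases D' rule: rev_cases) auto
    ultimately show ?thesis using that[of p M q] D(2) by (cases M) auto
  qed
  have all: "cycle_edges c = {{x, p}, {q, x}} \<union> path_edges D"
    using path_edges_append[of "x # p # M" q "[x]"]
    by (auto simp: c cycle_edges_Cons pMq(1))
  have noX: "x \<notin> e" if "e \<in> path_edges D" for e
    using path_edges_subset[OF that] D(1) by auto
  have "v = p \<or> v = q" if "{x, v} \<in> cycle_edges c" for v
  proof -
    have "{x, v} \<notin> path_edges D" using noX[of "{x, v}"] by blast
    then show ?thesis using that unfolding all by (auto simp: doubleton_eq_iff)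
  qed
  then have "y = p \<or> y = q" "z = p \<or> z = q" using edges by simp_all
  then have yz: "{y, z} = {p, q}" using xyz(1) by auto
  have "{p, q} \<in> cycle_edges c" using edges unfolding yz by simp
  moreover have "{p, q} \<noteq> {x, p}" "{p, q} \<noteq> {q, x}"
    using D(1) by (auto simp: pMq(1) doubleton_eq_iff)
  ultimately have "{p, q} \<in> path_edges D" unfolding all by simp
  moreover obtain m M' where m: "M = m # M'" using pMq(2) by (cases M) auto
  \<comment> \<open>The first edge of \<open>D\<close> is \<open>{p, m}\<close> with
    \<open>m\<close> different from \<open>q\<close>, so \<open>{p, q}\<close> would lie on the rest
    of the path, which avoids \<open>p\<close>.\<close>
  ultimately have "{p, q} \<in> path_edges (m # M' @ [q])"
    using D(1) by (auto simp: pMq(1) doubleton_eq_iff)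
  then show False using path_edges_subset[of "{p, q}"] D(1) by (fastforce simp: pMq(1) m)
qed

theorem theorem2:
  fixes V :: "'a set" and E :: "'a set set" and r :: nat
  assumes "simple_graph V E"
    and "wheel_free V E"
    and "r > 0"
  shows "chordal_upto r V E \<longleftrightarrow>
    (\<forall>c. is_cycle V E c \<and> length c \<le> r \<longrightarrow> generated_by (triangles V E) (cycle_edges c))"
proof
  have card2: "card e = 2" if "e \<in> E" for e
    using assms(1) that unfolding simple_graph_def by blast
  show "\<forall>c. is_cycle V E c \<and> length c \<le> r \<longrightarrow> generated_by (triangles V E) (cycle_edges c)"
    if "chordal_upto r V E"
    using chordal_cycle_generated_by_triangles[OF card2 that] by blast
  assume gen: "\<forall>c. is_cycle V E c \<and> length c \<le> r \<longrightarrow> generated_by (triangles V E) (cycle_edges c)"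
  show "chordal_upto r V E"
    unfolding chordal_upto_def
  proof (intro allI impI, elim conjE, rule ccontr)
    fix c assume c: "is_cycle V E c" "4 \<le> length c" "length c \<le> r" "\<not> has_chord E c"
    \<comment> \<open>\<open>V\<close> may be infinite, but a finite sum of triangles meets only
      finitely many vertices, so the elimination terminates.\<close>
    obtain F where F: "finite F" "F \<subseteq> V" "generated_by (triangles F E) (cycle_edges c)"
      using generated_by_triangles_finite[of V E "cycle_edges c"] gen c(1,3) by blast
    \<comment> \<open>All of \<open>set c\<close> is added so that exactly \<open>set c\<close>
      remains once \<open>F - set c\<close> is eliminated.\<close>
    have "generated_by (triangles ((F - set c) \<union> set c) E) (cycle_edges c)"
      using F(3) by (rule generated_by_mono) (rule triangles_mono, blast)
    then have "generated_by (triangles (set c) E) (cycle_edges c)"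
      using F c(1) cycle_edges_subset[of _ c]
      by (intro wheel_free_eliminate_vertices[OF card2 assms(2), of "F - set c" "set c"])
        (auto simp: is_cycle_def)
    moreover have "triangles (set c) E = {}"
      using c chordless_cycle_no_triangles[of c E] by (simp add: is_cycle_def)
    \<comment> \<open>Without generators only the empty sum is left.\<close>
    ultimately have "cycle_edges c = {}" by (simp add: generated_by_def)
    then show False using c(2) cycle_edges_nonempty[of c] by force
  qed
qed

end
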